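(* Let $X$ be a finite universe and $E$ a finite set of parameters. For type-2 soft sets $[\mathscr{F},A],[\mathscr{G},B]\in S_2(X,E)$ and $\alpha\in A\cup B$ define $$S(\alpha)=\begin{cases}\dfrac{1}{|E_A^\alpha\cup E_B^\alpha|}\displaystyle\sum_{\beta\in E_A^\alpha\cap E_B^\alpha}\frac{|F_\alpha(\beta)\cap G_\alpha(\beta)|}{|F_\alpha(\beta)\cup G_\alpha(\beta)|} & \text{if }\alpha\in A\cap B\text{ and }E_A^\alpha\cap E_B^\alpha\ne\varnothing,\\[4pt] 0&\text{otherwise.}\end{cases}$$ Then $S$ is a soft real number valued similarity measure between $[\mathscr{F},A]$ and $[\mathscr{G},B]$.
   Context: A type-1 soft set over $(X,E)$ is a pair $(F,P)$ with $P\subseteq E$ and $F:P\to\mathscr{P}(X)$. Containment: $(F,P)\,\tilde\subseteq\,(G,Q)$ iff $P\subseteq Q$ and $F(\beta)=G(\beta)$ for all $\beta\in P$; equality is mutual containment. For $Q\subseteq E$, $S(X,Q)$ is the set of type-1 soft sets whose parameter set is contained in $Q$. A type-2 soft set $[\mathscr{F},A]$ over $(X,E)$ consists of a set $A\subseteq E$ (primary parameters), a set $E_A\subseteq E$ (underlying parameters) and a mapping $\mathscr{F}:A\to S(X,E_A)$; write $\mathscr{F}(\alpha)=(F_\alpha,E_A^\alpha)$ with $E_A^\alpha\subseteq E_A$ and $F_\alpha:E_A^\alpha\to\mathscr{P}(X)$; it is required that $\bigcup_{\alpha\in A}E_A^\alpha=E_A$. (The sets $E_A^\alpha$, $E_A$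 belong to $[\mathscr{F},A]$, not merely to $A$; for $[\mathscr{G},B]$ one writes $(G_\alpha,E_B^\alpha)$ and $E_B$.) $S_2(X,E)$ is the set of all type-2 soft sets over $(X,E)$. $[\mathscr{F},A]$ and $[\mathscr{G},B]$ are disjoint if $A\cap B=\varnothing$. The formula for $S(\alpha)$ is considered for pairs for which its quotients are defined, i.e. $F_\alpha(\beta)\cup G_\alpha(\beta)\ne\varnothing$ for all $\beta$ occurring in the sum. A soft real number valued similarity measure assigns to each pair $[\mathscr{F},A],[\mathscr{G},B]$ a mapping on $A\cup B$ whose value at $\alpha$ is a real number (identified with a singleton subset of $\mathbb{R}$), denoted $S_\alpha((F_\alpha,E_A^\alpha),(G_\alpha,E_B^\alpha))$, such that: (s'1) $S_\alpha((F_\alpha,E_A^\alpha),(G_\alpha,E_B^\alpha))=S_\alpha((G_\alpha,E_B^\alpha),(F_\alpha,E_A^\alpha))$; (s'2) $0\le S_\alpha((F_\alpha,E_A^\alpha),(G_\alpha,E_B^\alpha))\le1$; (s'3) $S_\alpha((F_\alpha,E_A^\alpha),(G_\alpha,E_B^\alpha))=1$ iff $(F_\alpha,E_A^\alpha)=(G_\alpha,E_B^\alpha)$; (s'4) if $(F_\alpha,E_A^\alpha)\,\tilde\subseteq\,(G_\alpha,E_B^\alpha)\,\tilde\subseteq\,(H_\alpha,E_C^\alpha)$, then $S_\alpha((F_\alpha,E_A^\alpha),(H_\alpha,E_C^\alpha))\le\min\{S_\alpha((F_\alpha,E_A^\alpha),(G_\alpha,E_B^\alpha)),\,S_\alpha((G_\alpha,E_B^\alpha),(H_\alpha,E_C^\alpha))\}$;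 (s'5) $S_\alpha((F_\alpha,E_A^\alpha),(G_\alpha,E_B^\alpha))=0$ for all $\alpha\in A\cup B$ if $[\mathscr{F},A]$ and $[\mathscr{G},B]$ are disjoint. Conditions (s'1), (s'2), (s'5) are for $\alpha\in A\cup B$; in (s'3) and (s'4), equality and containment are considered for those $\alpha$ at which all the type-1 soft sets involved are defined.
   Formalization: Condition (s'3) is asserted only at α where E_A^α and E_B^α are not both empty; if both are empty the two type-1 soft sets are equal but S(α)=0, so (s'3) fails there. All other conditions are proved without this restriction. *)

theory Defs
  imports Complex_Main "HOL-Library.FuncSet"
begin

text \<open>
  A type-1 soft set \<open>(F, P)\<close> is a pair of a function and its parameter set. Functions are
  extensional on their domain (\<open>\<rightarrow>\<^sub>E\<close>), so every soft set has exactly one representation.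
\<close>

type_synonym ('e, 'x) soft1 = "('e \<Rightarrow> 'x set) \<times> 'e set"

definition soft1_sets :: "'x set \<Rightarrow> 'e set \<Rightarrow> ('e, 'x) soft1 set" where
  "soft1_sets X Q = {(F, P). P \<subseteq> Q \<and> F \<in> P \<rightarrow>\<^sub>E Pow X}"

definition soft1_subset :: "('e, 'x) soft1 \<Rightarrow> ('e, 'x) soft1 \<Rightarrow> bool"  (infix "\<subseteq>\<^sub>s" 50) where
  "S \<subseteq>\<^sub>s T \<longleftrightarrow> snd S \<subseteq> snd T \<and> (\<forall>\<beta>\<in>snd S. fst S \<beta> = fst T \<beta>)"

definition soft1_eq :: "('e, 'x) soft1 \<Rightarrow> ('e, 'x) soft1 \<Rightarrow> bool"  (infix "=\<^sub>s" 50) where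
  "S =\<^sub>s T \<longleftrightarrow> S \<subseteq>\<^sub>s T \<and> T \<subseteq>\<^sub>s S"

record ('e, 'x) soft2 =
  prim :: "'e set"
  under :: "'e set"
  smap :: "'e \<Rightarrow> ('e, 'x) soft1"

text \<open>For \<open>\<F> = [\<F>, A]\<close>: \<open>val \<F> \<alpha>\<close> is \<open>F\<^sub>\<alpha>\<close> and \<open>par \<F> \<alpha>\<close> is \<open>E\<^sub>A\<^sup>\<alpha>\<close>, meaningful for \<open>\<alpha> \<in> A\<close>.\<close>

definition val :: "('e, 'x) soft2 \<Rightarrow> 'e \<Rightarrow> 'e \<Rightarrow> 'x set" where
  "val \<F> \<alpha> = fst (smap \<F> \<alpha>)"

definition par :: "('e, 'x) soft2 \<Rightarrow> 'e \<Rightarrow> 'e set" where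
  "par \<F> \<alpha> = snd (smap \<F> \<alpha>)"

definition soft2_sets :: "'x set \<Rightarrow> 'e set \<Rightarrow> ('e, 'x) soft2 set" where
  "soft2_sets X E =
     {\<F>. prim \<F> \<subseteq> E \<and> under \<F> \<subseteq> E \<and>
         smap \<F> \<in> prim \<F> \<rightarrow>\<^sub>E soft1_sets X (under \<F>) \<and>
         (\<Union>\<alpha>\<in>prim \<F>. par \<F> \<alpha>) = under \<F>}"

definition soft2_disjoint :: "('e, 'x) soft2 \<Rightarrow> ('e, 'x) soft2 \<Rightarrow> bool" where
  "soft2_disjoint \<F> \<G> \<longleftrightarrow> prim \<F> \<inter> prim \<G> = {}"

text \<open>
  A candidate measure \<open>S\<close> sends a pair of type-2 soft sets to a real-valued function, of which
  only the values on \<open>A \<union> B\<close> matter. Since a formula may be meaningful only for some pairs at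
  some parameters, the axioms are relative to a domain \<open>D\<close>: \<open>D \<F> \<G> \<alpha>\<close> says that the value
  \<open>S \<F> \<G> \<alpha>\<close> is under consideration.
\<close>

type_synonym ('e, 'x) sim = "('e, 'x) soft2 \<Rightarrow> ('e, 'x) soft2 \<Rightarrow> 'e \<Rightarrow> real"
type_synonym ('e, 'x) sim_dom = "('e, 'x) soft2 \<Rightarrow> ('e, 'x) soft2 \<Rightarrow> 'e \<Rightarrow> bool"

definition sim_symmetric :: "'x set \<Rightarrow> 'e set \<Rightarrow> ('e, 'x) sim_dom \<Rightarrow> ('e, 'x) sim \<Rightarrow> bool" where
  "sim_symmetric X E D S \<longleftrightarrow>
     (\<forall>\<F>\<in>soft2_sets X E. \<forall>\<G>\<in>soft2_sets X E. \<forall>\<alpha>\<in>prim \<F> \<union> prim \<G>.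
        D \<F> \<G> \<alpha> \<longrightarrow> S \<F> \<G> \<alpha> = S \<G> \<F> \<alpha>)"

definition sim_bounded :: "'x set \<Rightarrow> 'e set \<Rightarrow> ('e, 'x) sim_dom \<Rightarrow> ('e, 'x) sim \<Rightarrow> bool" where
  "sim_bounded X E D S \<longleftrightarrow>
     (\<forall>\<F>\<in>soft2_sets X E. \<forall>\<G>\<in>soft2_sets X E. \<forall>\<alpha>\<in>prim \<F> \<union> prim \<G>.
        D \<F> \<G> \<alpha> \<longrightarrow> 0 \<le> S \<F> \<G> \<alpha> \<and> S \<F> \<G> \<alpha> \<le> 1)"

definition sim_separating :: "'x set \<Rightarrow> 'e set \<Rightarrow> ('e, 'x) sim_dom \<Rightarrow> ('e, 'x) sim \<Rightarrow> bool" where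
  "sim_separating X E D S \<longleftrightarrow>
     (\<forall>\<F>\<in>soft2_sets X E. \<forall>\<G>\<in>soft2_sets X E. \<forall>\<alpha>\<in>prim \<F> \<inter> prim \<G>.
        D \<F> \<G> \<alpha> \<longrightarrow> (S \<F> \<G> \<alpha> = 1 \<longleftrightarrow> smap \<F> \<alpha> =\<^sub>s smap \<G> \<alpha>))"

definition sim_monotone :: "'x set \<Rightarrow> 'e set \<Rightarrow> ('e, 'x) sim_dom \<Rightarrow> ('e, 'x) sim \<Rightarrow> bool" where
  "sim_monotone X E D S \<longleftrightarrow>
     (\<forall>\<F>\<in>soft2_sets X E. \<forall>\<G>\<in>soft2_sets X E. \<forall>\<H>\<in>soft2_sets X E.
      \<forall>\<alpha>\<in>prim \<F> \<inter> prim \<G> \<inter> prim \<H>.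
        D \<F> \<G> \<alpha> \<and> D \<G> \<H> \<alpha> \<and> D \<F> \<H> \<alpha> \<longrightarrow>
        smap \<F> \<alpha> \<subseteq>\<^sub>s smap \<G> \<alpha> \<and> smap \<G> \<alpha> \<subseteq>\<^sub>s smap \<H> \<alpha> \<longrightarrow>
        S \<F> \<H> \<alpha> \<le> min (S \<F> \<G> \<alpha>) (S \<G> \<H> \<alpha>))"

definition sim_disjoint_zero :: "'x set \<Rightarrow> 'e set \<Rightarrow> ('e, 'x) sim_dom \<Rightarrow> ('e, 'x) sim \<Rightarrow> bool" where
  "sim_disjoint_zero X E D S \<longleftrightarrow>
     (\<forall>\<F>\<in>soft2_sets X E. \<forall>\<G>\<in>soft2_sets X E. soft2_disjoint \<F> \<G> \<longrightarrow>
        (\<forall>\<alpha>\<in>prim \<F> \<union> prim \<G>. D \<F> \<G> \<alpha> \<longrightarrow> S \<F> \<G> \<alpha> = 0))"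

definition soft_real_similarity_measure ::
    "'x set \<Rightarrow> 'e set \<Rightarrow> ('e, 'x) sim_dom \<Rightarrow> ('e, 'x) sim \<Rightarrow> bool" where
  "soft_real_similarity_measure X E D S \<longleftrightarrow>
     sim_symmetric X E D S \<and> sim_bounded X E D S \<and> sim_separating X E D S \<and>
     sim_monotone X E D S \<and> sim_disjoint_zero X E D S"

definition jaccard_sim :: "('e, 'x) sim" where
  "jaccard_sim \<F> \<G> \<alpha> =
     (if \<alpha> \<in> prim \<F> \<inter> prim \<G> \<and> par \<F> \<alpha> \<inter> par \<G> \<alpha> \<noteq> {}
      then 1 / real (card (par \<F> \<alpha> \<union> par \<G> \<alpha>)) *
           (\<Sum>\<beta>\<in>par \<F> \<alpha> \<inter> par \<G> \<alpha>.
              real (card (val \<F> \<alpha> \<beta> \<inter> val \<G> \<alpha> \<beta>)) / real (card (val \<F> \<alpha> \<beta> \<union> val \<G> \<alpha> \<beta>)))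
      else 0)"

definition quotients_defined :: "('e, 'x) sim_dom" where
  "quotients_defined \<F> \<G> \<alpha> \<longleftrightarrow>
     (\<alpha> \<in> prim \<F> \<inter> prim \<G> \<longrightarrow>
      (\<forall>\<beta>\<in>par \<F> \<alpha> \<inter> par \<G> \<alpha>. val \<F> \<alpha> \<beta> \<union> val \<G> \<alpha> \<beta> \<noteq> {}))"

text \<open>
  If \<open>E\<^sub>A\<^sup>\<alpha> = E\<^sub>B\<^sup>\<alpha> = {}\<close>, the two type-1 soft sets at \<open>\<alpha>\<close> are equal, but \<open>jaccard_sim\<close> is 0 there by
  its second case (and the factor \<open>1 / |E\<^sub>A\<^sup>\<alpha> \<union> E\<^sub>B\<^sup>\<alpha>|\<close> would be undefined), so the separation
  axiom fails at such \<open>\<alpha>\<close>.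
\<close>

definition both_empty :: "('e, 'x) sim_dom" where
  "both_empty \<F> \<G> \<alpha> \<longleftrightarrow> \<alpha> \<in> prim \<F> \<inter> prim \<G> \<and> par \<F> \<alpha> \<union> par \<G> \<alpha> = {}"

end

theory Submission
  imports Defs
begin

text \<open>
  Each quotient is at most 1, with equality iff the two values agree, so the sum is at most
  \<open>|E\<^sub>A\<^sup>\<alpha> \<inter> E\<^sub>B\<^sup>\<alpha>| \<le> |E\<^sub>A\<^sup>\<alpha> \<union> E\<^sub>B\<^sup>\<alpha>|\<close>; the measure is 1 iff both inequalities are equalities, i.e. iff
  the parameter sets and the values coincide. If one type-1 soft set is contained in the other,
  all quotients are 1 and the measure is \<open>|E\<^sub>A\<^sup>\<alpha>| / |E\<^sub>B\<^sup>\<alpha>|\<close>, from which monotonicity is immediate.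
\<close>

text \<open>The Jaccard index. Division by zero yields 0, so \<open>jaccard {} {} = 0\<close>: the
  upper bound 1 survives for two empty sets, but \<open>jaccard A A = 1\<close> does not.\<close>

definition jaccard :: "'a set \<Rightarrow> 'a set \<Rightarrow> real" where
  "jaccard A B = real (card (A \<inter> B)) / real (card (A \<union> B))"

lemma jaccard_commute: "jaccard A B = jaccard B A"
  by (simp add: jaccard_def Int_commute Un_commute)

lemma jaccard_nonneg: "0 \<le> jaccard A B"
  by (simp add: jaccard_def)

lemma jaccard_le_1:
  assumes "finite A" "finite B"
  shows "jaccard A B \<le> 1"
proof -
  have "card (A \<inter> B) \<le> card (A \<union> B)"
    using assms by (intro card_mono) auto
  then show ?thesis
    by (simp add: jaccard_def divide_le_eq_1 neq0_conv[symmetric] del: neq0_conv)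
qed

lemma jaccard_self: "finite A \<Longrightarrow> A \<noteq> {} \<Longrightarrow> jaccard A A = 1"
  by (simp add: jaccard_def)

lemma jaccard_eq_1D:
  assumes "finite A" "finite B" "jaccard A B = 1"
  shows "A = B"
proof -
  \<comment> \<open>A quotient equal to 1 has a nonzero denominator, because x / 0 is 0.\<close>
  have "card (A \<inter> B) = card (A \<union> B)"
    using assms(3) by (simp add: jaccard_def divide_eq_1_iff)
  then have "A \<inter> B = A \<union> B"
    using assms(1,2) by (intro card_subset_eq) auto
  then show ?thesis by blast
qed

text \<open>If the parameter sets do not meet, the sum is empty and gives the same 0 as the second
  case of \<open>jaccard_sim\<close>. Later proofs thus split only on whether \<alpha> is a common
  primary parameter.\<close>

lemma jaccard_sim_eq:
  "jaccard_sim \<F> \<G> \<alpha> =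
     (if \<alpha> \<in> prim \<F> \<inter> prim \<G>
      then (\<Sum>\<beta>\<in>par \<F> \<alpha> \<inter> par \<G> \<alpha>. jaccard (val \<F> \<alpha> \<beta>) (val \<G> \<alpha> \<beta>))
             / real (card (par \<F> \<alpha> \<union> par \<G> \<alpha>))
      else 0)"
  by (simp add: jaccard_sim_def jaccard_def)

lemma jaccard_sim_commute: "jaccard_sim \<F> \<G> \<alpha> = jaccard_sim \<G> \<F> \<alpha>"
  by (simp add: jaccard_sim_eq Int_commute Un_commute jaccard_commute)

text \<open>By the union condition \<open>par \<F> \<alpha>\<close> lies in
  \<open>under \<F>\<close>, which lies in \<open>E\<close>.\<close>

lemma soft2_sets_par_subset:
  assumes "\<F> \<in> soft2_sets X E" "\<alpha> \<in> prim \<F>"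
  shows "par \<F> \<alpha> \<subseteq> E"
  using assms unfolding soft2_sets_def by blast

lemma soft2_sets_val_subset:
  assumes "\<F> \<in> soft2_sets X E" "\<alpha> \<in> prim \<F>" "\<beta> \<in> par \<F> \<alpha>"
  shows "val \<F> \<alpha> \<beta> \<subseteq> X"
proof -
  have "smap \<F> \<alpha> \<in> soft1_sets X (under \<F>)"
    using assms(1,2) by (auto simp: soft2_sets_def)
  then have "val \<F> \<alpha> \<in> par \<F> \<alpha> \<rightarrow>\<^sub>E Pow X"
    by (simp add: soft1_sets_def val_def par_def case_prod_beta)
  with assms(3) show ?thesis by blast
qed

lemma soft1_subset_smap_iff:
  "smap \<F> \<alpha> \<subseteq>\<^sub>s smap \<G> \<alpha> \<longleftrightarrow>
     par \<F> \<alpha> \<subseteq> par \<G> \<alpha> \<and> (\<forall>\<beta>\<in>par \<F> \<alpha>. val \<F> \<alpha> \<beta> = val \<G> \<alpha> \<beta>)"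
  by (simp add: soft1_subset_def par_def val_def)

lemma soft1_eq_smap_iff:
  "smap \<F> \<alpha> =\<^sub>s smap \<G> \<alpha> \<longleftrightarrow>
     par \<F> \<alpha> = par \<G> \<alpha> \<and> (\<forall>\<beta>\<in>par \<F> \<alpha>. val \<F> \<alpha> \<beta> = val \<G> \<alpha> \<beta>)"
  by (auto simp: soft1_eq_def soft1_subset_smap_iff)

context
  fixes X :: "'x set" and E :: "'e set"
  assumes finite_X: "finite X" and finite_E: "finite E"
begin

lemma finite_par: "\<F> \<in> soft2_sets X E \<Longrightarrow> \<alpha> \<in> prim \<F> \<Longrightarrow> finite (par \<F> \<alpha>)"
  using finite_E soft2_sets_par_subset finite_subset by metis

lemma finite_val:
  "\<F> \<in> soft2_sets X E \<Longrightarrow> \<alpha> \<in> prim \<F> \<Longrightarrow> \<beta> \<in> par \<F> \<alpha> \<Longrightarrow> finite (val \<F> \<alpha> \<beta>)"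
  using finite_X soft2_sets_val_subset finite_subset by metis

context
  fixes \<F> \<G> :: "('e, 'x) soft2" and \<alpha> :: 'e
  assumes sets: "\<F> \<in> soft2_sets X E" "\<G> \<in> soft2_sets X E"
begin

lemma jaccard_val_le_1:
  assumes "\<alpha> \<in> prim \<F> \<inter> prim \<G>" "\<beta> \<in> par \<F> \<alpha> \<inter> par \<G> \<alpha>"
  shows "jaccard (val \<F> \<alpha> \<beta>) (val \<G> \<alpha> \<beta>) \<le> 1"
  using assms sets by (intro jaccard_le_1 finite_val) auto

lemma sum_jaccard_le_card_Int:
  assumes "\<alpha> \<in> prim \<F> \<inter> prim \<G>"
  shows "(\<Sum>\<beta>\<in>par \<F> \<alpha> \<inter> par \<G> \<alpha>. jaccard (val \<F> \<alpha> \<beta>) (val \<G> \<alpha> \<beta>))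
           \<le> real (card (par \<F> \<alpha> \<inter> par \<G> \<alpha>))"
proof -
  have "(\<Sum>\<beta>\<in>par \<F> \<alpha> \<inter> par \<G> \<alpha>. jaccard (val \<F> \<alpha> \<beta>) (val \<G> \<alpha> \<beta>))
          \<le> (\<Sum>\<beta>\<in>par \<F> \<alpha> \<inter> par \<G> \<alpha>. 1)"
    by (rule sum_mono) (rule jaccard_val_le_1[OF assms])
  then show ?thesis by simp
qed

lemma card_par_Int_le_card_par_Un:
  assumes "\<alpha> \<in> prim \<F> \<inter> prim \<G>"
  shows "card (par \<F> \<alpha> \<inter> par \<G> \<alpha>) \<le> card (par \<F> \<alpha> \<union> par \<G> \<alpha>)"
  using assms sets finite_par by (intro card_mono) auto

lemma jaccard_sim_nonneg: "0 \<le> jaccard_sim \<F> \<G> \<alpha>"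
  by (simp add: jaccard_sim_eq sum_nonneg jaccard_nonneg)

lemma jaccard_sim_le_1: "jaccard_sim \<F> \<G> \<alpha> \<le> 1"
proof (cases "\<alpha> \<in> prim \<F> \<inter> prim \<G>")
  case True
  have "(\<Sum>\<beta>\<in>par \<F> \<alpha> \<inter> par \<G> \<alpha>. jaccard (val \<F> \<alpha> \<beta>) (val \<G> \<alpha> \<beta>))
          \<le> real (card (par \<F> \<alpha> \<union> par \<G> \<alpha>))"
    using sum_jaccard_le_card_Int[OF True] card_par_Int_le_card_par_Un[OF True] by linarith
  \<comment> \<open>If both parameter sets are empty, the denominator is 0 and so is the value;
    otherwise the bound on the sum can be divided by a positive number.\<close>
  then show ?thesis
    using True by (simp add: jaccard_sim_eq divide_le_eq_1 neq0_conv[symmetric] del: neq0_conv)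
qed (auto simp: jaccard_sim_eq)

lemma jaccard_sim_eq_1D:
  assumes prim: "\<alpha> \<in> prim \<F> \<inter> prim \<G>" and eq_1: "jaccard_sim \<F> \<G> \<alpha> = 1"
  shows "smap \<F> \<alpha> =\<^sub>s smap \<G> \<alpha>"
proof -
  let ?I = "par \<F> \<alpha> \<inter> par \<G> \<alpha>" and ?U = "par \<F> \<alpha> \<union> par \<G> \<alpha>"
  let ?q = "\<lambda>\<beta>. jaccard (val \<F> \<alpha> \<beta>) (val \<G> \<alpha> \<beta>)"
  have fin: "finite ?U" using prim sets finite_par by auto
  have sum: "sum ?q ?I = real (card ?U)"
    using prim eq_1 by (simp add: jaccard_sim_eq divide_eq_1_iff)
  \<comment> \<open>The sum is at most \<open>card ?I\<close>, which is at most
    \<open>card ?U\<close>, which is the sum: the chain collapses.\<close>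
  have card: "card ?I = card ?U"
    using sum sum_jaccard_le_card_Int[OF prim] card_par_Int_le_card_par_Un[OF prim] by linarith
  then have "?I = ?U"
    using fin by (intro card_subset_eq) auto
  then have par: "par \<F> \<alpha> = par \<G> \<alpha>" by blast
  \<comment> \<open>The defects \<open>1 - ?q \<beta>\<close> are nonnegative and sum to 0, so each
    of them vanishes.\<close>
  have "(\<Sum>\<beta>\<in>?I. 1 - ?q \<beta>) = 0"
    using sum card by (simp add: sum_subtractf)
  then have "\<forall>\<beta>\<in>?I. 1 - ?q \<beta> = 0"
    using fin jaccard_val_le_1[OF prim] by (subst (asm) sum_nonneg_eq_0_iff) auto
  then have "\<forall>\<beta>\<in>?I. val \<F> \<alpha> \<beta> = val \<G> \<alpha> \<beta>"
    using prim sets by (metis IntE eq_iff_diff_eq_0 finite_val jaccard_eq_1D)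
  with par show ?thesis
    by (simp add: soft1_eq_smap_iff)
qed

lemma jaccard_sim_if_soft1_subset:
  assumes prim: "\<alpha> \<in> prim \<F> \<inter> prim \<G>" and "quotients_defined \<F> \<G> \<alpha>"
    and "smap \<F> \<alpha> \<subseteq>\<^sub>s smap \<G> \<alpha>"
  shows "jaccard_sim \<F> \<G> \<alpha> = real (card (par \<F> \<alpha>)) / real (card (par \<G> \<alpha>))"
proof -
  have sub: "par \<F> \<alpha> \<subseteq> par \<G> \<alpha>" and val: "\<forall>\<beta>\<in>par \<F> \<alpha>. val \<F> \<alpha> \<beta> = val \<G> \<alpha> \<beta>"
    using assms(3) by (auto simp: soft1_subset_smap_iff)
  then have Int: "par \<F> \<alpha> \<inter> par \<G> \<alpha> = par \<F> \<alpha>" and Un: "par \<F> \<alpha> \<union> par \<G> \<alpha> = par \<G> \<alpha>" by auto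
  have "jaccard (val \<F> \<alpha> \<beta>) (val \<G> \<alpha> \<beta>) = 1" if "\<beta> \<in> par \<F> \<alpha>" for \<beta>
  proof -
    \<comment> \<open>Both values coincide, so their nonempty union is the common value. An empty
      common value would contribute 0 to the sum instead of 1.\<close>
    have "val \<G> \<alpha> \<beta> \<noteq> {}"
      using assms(1,2) that sub val by (auto simp: quotients_defined_def)
    moreover have "finite (val \<G> \<alpha> \<beta>)"
      using finite_val prim sets sub that by blast
    ultimately show ?thesis using val that by (simp add: jaccard_self)
  qed
  then show ?thesis
    using prim by (simp add: jaccard_sim_eq Int Un)
qed

lemma jaccard_sim_eq_1_iff:
  assumes "\<alpha> \<in> prim \<F> \<inter> prim \<G>" "quotients_defined \<F> \<G> \<alpha>" "\<not> both_empty \<F> \<G> \<alpha>"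
  shows "jaccard_sim \<F> \<G> \<alpha> = 1 \<longleftrightarrow> smap \<F> \<alpha> =\<^sub>s smap \<G> \<alpha>"
proof
  assume eq: "smap \<F> \<alpha> =\<^sub>s smap \<G> \<alpha>"
  then have par: "par \<F> \<alpha> = par \<G> \<alpha>" by (simp add: soft1_eq_smap_iff)
  \<comment> \<open>Equal soft sets give the ratio n / n, which is 1 only for nonzero n; excluding
    \<open>both_empty\<close> ensures this.\<close>
  then have "card (par \<G> \<alpha>) \<noteq> 0"
    using assms(1,3) sets finite_par by (auto simp: both_empty_def)
  moreover have "smap \<F> \<alpha> \<subseteq>\<^sub>s smap \<G> \<alpha>" using eq by (simp add: soft1_eq_def)
  ultimately show "jaccard_sim \<F> \<G> \<alpha> = 1"
    using jaccard_sim_if_soft1_subset[OF assms(1,2)] par by simp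
qed (rule jaccard_sim_eq_1D[OF assms(1)])

end

text \<open>By transitivity of containment all three similarities are ratios of cardinalities a
  \<le> b \<le> c, and a / c is at most both a / b and b / c.\<close>

lemma jaccard_sim_mono:
  assumes sets: "\<F> \<in> soft2_sets X E" "\<G> \<in> soft2_sets X E" "\<H> \<in> soft2_sets X E"
    and prim: "\<alpha> \<in> prim \<F> \<inter> prim \<G> \<inter> prim \<H>"
    and defined: "quotients_defined \<F> \<G> \<alpha>" "quotients_defined \<G> \<H> \<alpha>" "quotients_defined \<F> \<H> \<alpha>"
    and sub: "smap \<F> \<alpha> \<subseteq>\<^sub>s smap \<G> \<alpha>" "smap \<G> \<alpha> \<subseteq>\<^sub>s smap \<H> \<alpha>"
  shows "jaccard_sim \<F> \<H> \<alpha> \<le> min (jaccard_sim \<F> \<G> \<alpha>) (jaccard_sim \<G> \<H> \<alpha>)"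
proof -
  have "smap \<F> \<alpha> \<subseteq>\<^sub>s smap \<H> \<alpha>"
    using sub by (auto simp: soft1_subset_smap_iff)
  then have ratios:
    "jaccard_sim \<F> \<G> \<alpha> = real (card (par \<F> \<alpha>)) / real (card (par \<G> \<alpha>))"
    "jaccard_sim \<G> \<H> \<alpha> = real (card (par \<G> \<alpha>)) / real (card (par \<H> \<alpha>))"
    "jaccard_sim \<F> \<H> \<alpha> = real (card (par \<F> \<alpha>)) / real (card (par \<H> \<alpha>))"
    using prim sub defined sets by (simp_all add: jaccard_sim_if_soft1_subset)
  have le: "card (par \<F> \<alpha>) \<le> card (par \<G> \<alpha>)" "card (par \<G> \<alpha>) \<le> card (par \<H> \<alpha>)"
    using sub prim sets by (auto simp: soft1_subset_smap_iff intro!: card_mono finite_par)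
  have "jaccard_sim \<F> \<H> \<alpha> \<le> jaccard_sim \<F> \<G> \<alpha>"
  \<comment> \<open>For b = 0 the ratio a / b is 0 by convention, but then a = 0 as well, so a / c
    is also 0. For b > 0 also c > 0, and enlarging the denominator decreases the ratio.\<close>
  proof (cases "card (par \<G> \<alpha>) = 0")
    case False
    then show ?thesis
      unfolding ratios using le by (intro divide_left_mono mult_pos_pos) auto
  qed (use ratios le in simp)
  moreover have "jaccard_sim \<F> \<H> \<alpha> \<le> jaccard_sim \<G> \<H> \<alpha>"
    unfolding ratios using le by (intro divide_right_mono) auto
  ultimately show ?thesis by simp
qed

end

text \<open>Excluding \<open>both_empty\<close> serves separation alone; the last four conjuncts
  record that the other axioms survive wherever the quotients are defined.\<close>

theorem theorem5p4:
  fixes X :: "'x set" and E :: "'e set"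
  assumes "finite X" and "finite E"
  shows "soft_real_similarity_measure X E
           (\<lambda>\<F> \<G> \<alpha>. quotients_defined \<F> \<G> \<alpha> \<and> \<not> both_empty \<F> \<G> \<alpha>) jaccard_sim
       \<and> sim_symmetric X E quotients_defined jaccard_sim
       \<and> sim_bounded X E quotients_defined jaccard_sim
       \<and> sim_monotone X E quotients_defined jaccard_sim
       \<and> sim_disjoint_zero X E quotients_defined jaccard_sim"
proof -
  let ?D = "\<lambda>\<F> \<G> \<alpha>. quotients_defined \<F> \<G> \<alpha> \<and> \<not> both_empty \<F> \<G> \<alpha>"
  \<comment> \<open>These three axioms hold for an arbitrary domain \<open>D\<close>, so that each
    can be instantiated with both domains of the claim.\<close>
  have symmetric: "sim_symmetric X E D jaccard_sim" for D
    unfolding sim_symmetric_def by (intro ballI impI) (rule jaccard_sim_commute)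
  have bounded: "sim_bounded X E D jaccard_sim" for D
    by (simp add: sim_bounded_def jaccard_sim_nonneg[OF assms] jaccard_sim_le_1[OF assms])
  have disjoint_zero: "sim_disjoint_zero X E D jaccard_sim" for D
    unfolding sim_disjoint_zero_def soft2_disjoint_def by (auto simp: jaccard_sim_eq)
  have monotone: "sim_monotone X E quotients_defined jaccard_sim"
    unfolding sim_monotone_def
    by (intro ballI impI, elim conjE) (rule jaccard_sim_mono[OF assms])
  \<comment> \<open>The domain occurs only as a premise, so monotonicity passes to the smaller
    domain \<open>?D\<close>.\<close>
  then have "sim_monotone X E ?D jaccard_sim"
    unfolding sim_monotone_def by blast
  moreover have "sim_separating X E ?D jaccard_sim"
    unfolding sim_separating_def
    by (intro ballI impI, elim conjE) (rule jaccard_sim_eq_1_iff[OF assms])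
  ultimately show ?thesis
    unfolding soft_real_similarity_measure_def
    using symmetric bounded disjoint_zero monotone by blast
qed

end
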